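(* Let $u_h^n$ be the solution of the fully discrete L1-NIPG scheme. Then there is a constant $C>0$, independent of the step lengths and meshes in space and time, such that $$\|u_h^n\|\le\|u_h^1\|+C\,T^{\alpha}\max_{1\le j\le n}\|f^j\|,\qquad n=2,3,\dots,N+1,$$ where $\|\cdot\|$ is the $L^2(\Omega)$ norm and $f^j=f(\cdot,t_j)$.
   Context: **Data.** $0<\alpha<1$, $\ell,T>0$, $\Omega=(0,\ell)$; $a\in C^1(\overline\Omega)$, $b\in C(\overline\Omega)$, $p\in C([0,T])$ with $a>0$, $p>0$, $b\ge 0$; $g$ is the initial datum with $g(0)=g(\ell)=0$; $f$ is the source term. (The underlying problem is ${}^{C}\mathcal{D}^{\alpha}_t u+p(t)[-\partial_y(a\,\partial_y u)+bu]=f$ in $\Omega\times(0,T]$, $u(y,0)=g(y)$, $u(0,t)=u(\ell,t)=0$, with ${}^C\mathcal D_t^\alpha$ the Caputo derivative.) **Temporal mesh and L1 coefficients.** $N$ is a positive integer, $r\ge1$, $t_n=T\left(\frac{n-1}{N}\right)^r$ for $n=1,\dots,N+1$, $\tau_n=t_{n+1}-t_n$ for $n=1,\dots,N$. For $n\ge2$, $1\le j\le n-1$: $\widehat T_{n,j}=\dfrac{(t_n-t_j)^{1-\alpha}-(t_n-t_{j+1})^{1-\alpha}}{\tau_j\,\Gamma(2-\alpha)}$. **Spatial mesh and spaces.** $M$ is a positive integer, $h=\ell/M$, $y_m=(m-1)h$ ($m=1,\dots,M+1$), $\mathcal K_m=(y_m,y_{m+1})$. For $k\ge1$, $V^k_{0,h}(\Omega)=\{v\in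 L^2(\Omega): v|_{\mathcal K_m}\in\mathcal P^k(\mathcal K_m)\ \forall m,\ v(0)=v(\ell)=0\}$, where $\mathcal P^k$ denotes polynomials of degree at most $k$. Jumps and averages: $[v(y_m)]=v^+(y_m)-v^-(y_m)$, $\{v(y_m)\}=\frac12(v^+(y_m)+v^-(y_m))$ at interior nodes, and $[v(y_1)]=v(y_1)$, $\{v(y_1)\}=v(y_1)$, $[v(y_{M+1})]=-v(y_{M+1})$, $\{v(y_{M+1})\}=v(y_{M+1})$. Penalty parameters $\sigma_m\ge0$, $m=1,\dots,M+1$, are given. **Fully discrete L1-NIPG scheme.** $K^n(y)=p(t_n)a(y)$, $c^n(y)=p(t_n)b(y)+\widehat T_{n,n-1}$, $f^n(y)=f(y,t_n)$. $u_h^1\in V^k_{0,h}$ satisfies $\int_\Omega u_h^1v_h\,dy=\int_\Omega g v_h\,dy$ for all $v_h\in V^k_{0,h}$; for $n=2,\dots,N+1$, $u_h^n\in V^k_{0,h}$ satisfies $B(u_h^n,v_h)=\langle F^n,v_h\rangle$ for all $v_h\in V^k_{0,h}$, where $B(w,v)=B_1(w,v)+B_2(w,v)-B_2(v,w)+B_3(w,v)$ with $B_1(w,v)=\sum_{m=1}^M\int_{\mathcal K_m}(K^n w_yv_y+c^n wv)\,dy$, $B_2(w,v)=\sum_{m=1}^{M+1}\{K^n(y_m)w_y(y_m)\}[v(y_m)]$, $B_3(w,v)=\sum_{m=1}^{M+1}\sigma_m[w(y_m)][v(y_m)]$, and $\langle F^n,v\rangle=\sum_{m=1}^M\int_{\mathcal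 K_m}\big(f^n+\widehat T_{n,1}u_h^1+\sum_{j=2}^{n-1}(\widehat T_{n,j}-\widehat T_{n,j-1})u_h^j\big)v\,dy$. It is understood that $f^j\in L^2(\Omega)$ for $j=1,\dots,N+1$ (including $t_1=0$). *)

theory Defs
  imports "HOL-Analysis.Analysis"
begin

definition C1_on_Icc :: "real \<Rightarrow> (real \<Rightarrow> real) \<Rightarrow> bool" where
  "C1_on_Icc l a \<longleftrightarrow> (\<exists>a'. continuous_on {0..l} a' \<and>
     (\<forall>y\<in>{0..l}. (a has_real_derivative a' y) (at y within {0..l})))"

definition L2 :: "real \<Rightarrow> (real \<Rightarrow> real) set" where
  "L2 l = {v. v \<in> borel_measurable (lebesgue_on {0<..<l}) \<and>
              integrable (lebesgue_on {0<..<l}) (\<lambda>y. (v y)\<^sup>2)}"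

definition L2_norm :: "real \<Rightarrow> (real \<Rightarrow> real) \<Rightarrow> real" where
  "L2_norm l v = sqrt (\<integral>y. (v y)\<^sup>2 \<partial>lebesgue_on {0<..<l})"

text \<open>Mesh points are numbered from 1, so that time level 1 is the initial time.\<close>

definition tmesh :: "real \<Rightarrow> nat \<Rightarrow> real \<Rightarrow> nat \<Rightarrow> real" where
  "tmesh T N r n = T * ((real n - 1) / real N) powr r"

definition tstep :: "real \<Rightarrow> nat \<Rightarrow> real \<Rightarrow> nat \<Rightarrow> real" where
  "tstep T N r n = tmesh T N r (n + 1) - tmesh T N r n"

definition L1_coeff :: "real \<Rightarrow> real \<Rightarrow> nat \<Rightarrow> real \<Rightarrow> nat \<Rightarrow> nat \<Rightarrow> real" where
  "L1_coeff \<alpha> T N r n j =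
     ((tmesh T N r n - tmesh T N r j) powr (1 - \<alpha>)
        - (tmesh T N r n - tmesh T N r (j + 1)) powr (1 - \<alpha>))
     / (tstep T N r j * Gamma (2 - \<alpha>))"

definition ymesh :: "real \<Rightarrow> nat \<Rightarrow> nat \<Rightarrow> real" where
  "ymesh l M m = (real m - 1) * (l / real M)"

definition cell :: "real \<Rightarrow> nat \<Rightarrow> nat \<Rightarrow> real set" where
  "cell l M m = {ymesh l M m <..< ymesh l M (m + 1)}"

definition trace_right :: "(real \<Rightarrow> real) \<Rightarrow> real \<Rightarrow> real" where
  "trace_right v y = Lim (at_right y) v"

definition trace_left :: "(real \<Rightarrow> real) \<Rightarrow> real \<Rightarrow> real" where
  "trace_left v y = Lim (at_left y) v"

text \<open>
  Elements of the broken polynomial space are functions whose values at the nodes are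
  arbitrary (the cells are open), so nodal and boundary values are always understood
  as one-sided traces from inside the domain.
\<close>

definition dg_space :: "real \<Rightarrow> nat \<Rightarrow> nat \<Rightarrow> (real \<Rightarrow> real) set" where
  "dg_space l M k = {v. v \<in> L2 l \<and>
     (\<forall>m\<in>{1..M}. \<exists>q :: real poly. degree q \<le> k \<and> (\<forall>y\<in>cell l M m. v y = poly q y)) \<and>
     trace_right v 0 = 0 \<and> trace_left v l = 0}"

definition jump :: "real \<Rightarrow> nat \<Rightarrow> (real \<Rightarrow> real) \<Rightarrow> nat \<Rightarrow> real" where
  "jump l M v m =
     (if m = 1 then trace_right v (ymesh l M m)
      else if m = M + 1 then - trace_left v (ymesh l M m)
      else trace_right v (ymesh l M m) - trace_left v (ymesh l M m))"

definition average :: "real \<Rightarrow> nat \<Rightarrow> (real \<Rightarrow> real) \<Rightarrow> nat \<Rightarrow> real" where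
  "average l M v m =
     (if m = 1 then trace_right v (ymesh l M m)
      else if m = M + 1 then trace_left v (ymesh l M m)
      else (trace_right v (ymesh l M m) + trace_left v (ymesh l M m)) / 2)"

definition B1 :: "real \<Rightarrow> nat \<Rightarrow> (real \<Rightarrow> real) \<Rightarrow> (real \<Rightarrow> real)
    \<Rightarrow> (real \<Rightarrow> real) \<Rightarrow> (real \<Rightarrow> real) \<Rightarrow> real" where
  "B1 l M K c w v =
     (\<Sum>m=1..M. \<integral>y. K y * deriv w y * deriv v y + c y * w y * v y
                  \<partial>lebesgue_on (cell l M m))"

definition B2 :: "real \<Rightarrow> nat \<Rightarrow> (real \<Rightarrow> real)
    \<Rightarrow> (real \<Rightarrow> real) \<Rightarrow> (real \<Rightarrow> real) \<Rightarrow> real" where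
  "B2 l M K w v =
     (\<Sum>m=1..M+1. average l M (\<lambda>y. K y * deriv w y) m * jump l M v m)"

definition B3 :: "real \<Rightarrow> nat \<Rightarrow> (nat \<Rightarrow> real)
    \<Rightarrow> (real \<Rightarrow> real) \<Rightarrow> (real \<Rightarrow> real) \<Rightarrow> real" where
  "B3 l M \<sigma> w v = (\<Sum>m=1..M+1. \<sigma> m * jump l M w m * jump l M v m)"

definition nipg_form :: "real \<Rightarrow> nat \<Rightarrow> (nat \<Rightarrow> real) \<Rightarrow> (real \<Rightarrow> real) \<Rightarrow> (real \<Rightarrow> real)
    \<Rightarrow> (real \<Rightarrow> real) \<Rightarrow> (real \<Rightarrow> real) \<Rightarrow> real" where
  "nipg_form l M \<sigma> K c w v =
     B1 l M K c w v + B2 l M K w v - B2 l M K v w + B3 l M \<sigma> w v"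

definition L1_nipg_rhs :: "real \<Rightarrow> real \<Rightarrow> real \<Rightarrow> (real \<Rightarrow> real \<Rightarrow> real) \<Rightarrow> nat \<Rightarrow> real \<Rightarrow> nat
    \<Rightarrow> (nat \<Rightarrow> real \<Rightarrow> real) \<Rightarrow> nat \<Rightarrow> (real \<Rightarrow> real) \<Rightarrow> real" where
  "L1_nipg_rhs \<alpha> l T f N r M u n v =
     (\<Sum>m=1..M. \<integral>y. (f y (tmesh T N r n) + L1_coeff \<alpha> T N r n 1 * u 1 y
          + (\<Sum>j=2..n-1. (L1_coeff \<alpha> T N r n j - L1_coeff \<alpha> T N r n (j - 1)) * u j y)) * v y
        \<partial>lebesgue_on (cell l M m))"

definition L1_nipg_solution :: "real \<Rightarrow> real \<Rightarrow> real \<Rightarrow> (real \<Rightarrow> real) \<Rightarrow> (real \<Rightarrow> real)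
    \<Rightarrow> (real \<Rightarrow> real) \<Rightarrow> (real \<Rightarrow> real) \<Rightarrow> (real \<Rightarrow> real \<Rightarrow> real) \<Rightarrow> nat \<Rightarrow> real \<Rightarrow> nat \<Rightarrow> nat
    \<Rightarrow> (nat \<Rightarrow> real) \<Rightarrow> (nat \<Rightarrow> real \<Rightarrow> real) \<Rightarrow> bool" where
  "L1_nipg_solution \<alpha> l T a b p g f N r M k \<sigma> u \<longleftrightarrow>
     (\<forall>n\<in>{1..N+1}. u n \<in> dg_space l M k) \<and>
     (\<forall>v\<in>dg_space l M k.
        (\<integral>y. u 1 y * v y \<partial>lebesgue_on {0<..<l}) = (\<integral>y. g y * v y \<partial>lebesgue_on {0<..<l})) \<and>
     (\<forall>n\<in>{2..N+1}. \<forall>v\<in>dg_space l M k.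
        nipg_form l M \<sigma>
          (\<lambda>y. p (tmesh T N r n) * a y)
          (\<lambda>y. p (tmesh T N r n) * b y + L1_coeff \<alpha> T N r n (n - 1))
          (u n) v
        = L1_nipg_rhs \<alpha> l T f N r M u n v)"

end

theory Submission
  imports Defs
begin

text \<open>
  Testing a time step with its own solution \<open>u\<^sub>n\<close> removes everything that depends on the
  spatial discretisation: the two consistency terms of the nonsymmetric form cancel, and
  diffusion, reaction and penalty are nonnegative (\<open>nipg_form_diagonal_ge\<close>).
  Cauchy--Schwarz on the right-hand side (\<open>L1_nipg_rhs_le\<close>) and division by the norm of
  \<open>u\<^sub>n\<close> leave a scalar recursion for the norms \<open>x n\<close>,
  \<open>W n (n - 1) * x n \<le> F + W n 1 * x 1 + (\<Sum>j=2..n-1. (W n j - W n (j - 1)) * x j)\<close>,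
  where \<open>W\<close> stands for the L1 coefficients and \<open>F\<close> for the largest norm of the source.

  Each coefficient is a value of the kernel \<open>(t\<^sub>n - s) powr (- \<alpha>) / Gamma (1 - \<alpha>)\<close> inside
  its time interval (\<open>L1_coeff_mean_value\<close>).  On every mesh the coefficients therefore
  increase in \<open>j\<close>, which makes the weights of the recursion nonnegative, and they are all
  at least \<open>w = T powr (- \<alpha>) / Gamma (1 - \<alpha>)\<close>.  The weights sum to the coefficient on the
  left, so up to the source the recursion compares \<open>x n\<close> with a mean of earlier values;
  since \<open>x 1\<close> has weight at least \<open>w\<close>, this gives \<open>x n \<le> x 1 + F / w\<close>
  (\<open>weighted_mean_recursion_bound\<close>).  The constant is thus \<open>Gamma (1 - \<alpha>)\<close>.
\<close>

section \<open>Square-integrable functions\<close>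

lemma integrable_mult_of_square_integrable:
  fixes f g :: "'a \<Rightarrow> real"
  assumes [measurable]: "f \<in> borel_measurable M" "g \<in> borel_measurable M"
    and f: "integrable M (\<lambda>x. (f x)\<^sup>2)" and g: "integrable M (\<lambda>x. (g x)\<^sup>2)"
  shows "integrable M (\<lambda>x. f x * g x)"
proof (rule Bochner_Integration.integrable_bound[OF Bochner_Integration.integrable_add[OF f g]])
  show "AE x in M. norm (f x * g x) \<le> norm ((f x)\<^sup>2 + (g x)\<^sup>2)"
  proof (rule AE_I2)
    fix x
    have "2 * \<bar>f x * g x\<bar> \<le> (f x)\<^sup>2 + (g x)\<^sup>2"
      using sum_squares_bound[of "\<bar>f x\<bar>" "\<bar>g x\<bar>"] by (simp add: abs_mult mult.assoc)
    then show "norm (f x * g x) \<le> norm ((f x)\<^sup>2 + (g x)\<^sup>2)"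
      unfolding real_norm_def by linarith
  qed
qed measurable

text \<open>
  The square of \<open>f - s * g\<close> has a nonnegative integral for every real \<open>s\<close>.  When the
  integral of \<open>g\<^sup>2\<close> is positive, the minimising \<open>s\<close> gives the inequality; when it
  vanishes, this quadratic in \<open>s\<close> is affine, which forces the mixed integral to be zero.
\<close>

lemma integral_Cauchy_Schwarz:
  fixes f g :: "'a \<Rightarrow> real"
  assumes "f \<in> borel_measurable M" "g \<in> borel_measurable M"
    and f: "integrable M (\<lambda>x. (f x)\<^sup>2)" and g: "integrable M (\<lambda>x. (g x)\<^sup>2)"
  shows "(\<integral>x. f x * g x \<partial>M) \<le> sqrt (\<integral>x. (f x)\<^sup>2 \<partial>M) * sqrt (\<integral>x. (g x)\<^sup>2 \<partial>M)"
proof -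
  define A where "A = (\<integral>x. (f x)\<^sup>2 \<partial>M)"
  define B where "B = (\<integral>x. (g x)\<^sup>2 \<partial>M)"
  define D where "D = (\<integral>x. f x * g x \<partial>M)"
  have fg: "integrable M (\<lambda>x. f x * g x)"
    using assms by (rule integrable_mult_of_square_integrable)
  have B0: "0 \<le> B" unfolding B_def by simp
  have quad: "0 \<le> A - 2 * s * D + s\<^sup>2 * B" for s
  proof -
    have "0 \<le> (\<integral>x. (f x - s * g x)\<^sup>2 \<partial>M)" by simp
    also have "\<dots> = (\<integral>x. (f x)\<^sup>2 - (2 * s) * (f x * g x) + s\<^sup>2 * (g x)\<^sup>2 \<partial>M)"
      by (simp add: power2_diff power_mult_distrib algebra_simps)
    also have "\<dots> = A - 2 * s * D + s\<^sup>2 * B"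
      unfolding A_def B_def D_def using f g fg by simp
    finally show ?thesis .
  qed
  have "D\<^sup>2 \<le> A * B"
  proof (cases "B = 0")
    case True
    have "D = 0"
    proof (rule ccontr)
      assume "D \<noteq> 0"
      \<comment> \<open>the affine function \<open>A - 2 * s * D\<close> takes the value \<open>-1\<close> at this point\<close>
      then show False using quad[of "(A + 1) / (2 * D)"] True by simp
    qed
    then show ?thesis using True by simp
  next
    case False
    then show ?thesis
      using quad[of "D / B"] B0 by (simp add: field_simps power2_eq_square)
  qed
  then have "D \<le> sqrt (A * B)" by (rule real_le_rsqrt)
  then show ?thesis by (simp add: A_def B_def D_def real_sqrt_mult)
qed

lemma L2_integrable_mult:
  "v \<in> L2 l \<Longrightarrow> w \<in> L2 l \<Longrightarrow> integrable (lebesgue_on {0<..<l}) (\<lambda>y. v y * w y)"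
  unfolding L2_def by (auto intro: integrable_mult_of_square_integrable)

lemma L2_integral_mult_le:
  "v \<in> L2 l \<Longrightarrow> w \<in> L2 l
    \<Longrightarrow> (\<integral>y. v y * w y \<partial>lebesgue_on {0<..<l}) \<le> L2_norm l v * L2_norm l w"
  unfolding L2_def L2_norm_def by (auto intro: integral_Cauchy_Schwarz)

lemma L2_norm_nonneg: "0 \<le> L2_norm l v"
  by (simp add: L2_norm_def)

lemma L2_norm_square: "(L2_norm l v)\<^sup>2 = (\<integral>y. (v y)\<^sup>2 \<partial>lebesgue_on {0<..<l})"
  by (simp add: L2_norm_def)

section \<open>Integration cell by cell\<close>

lemma integrable_lebesgue_on_subset:
  fixes f :: "real \<Rightarrow> real"
  assumes "integrable (lebesgue_on S) f" "R \<subseteq> S" "R \<in> sets lebesgue" "S \<in> sets lebesgue"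
  shows "integrable (lebesgue_on R) f"
  using assms set_integrable_subset[of lebesgue S f R]
  by (simp add: integrable_restrict_space set_integrable_def)

lemma integral_lebesgue_on_Ioo:
  fixes f :: "real \<Rightarrow> real"
  assumes "integrable (lebesgue_on {s<..<t}) f"
  shows "(\<integral>y. f y \<partial>lebesgue_on {s<..<t}) = integral {s..t} f"
  using lebesgue_integral_eq_integral[OF assms] by (simp add: integral_open_interval_real)

lemma sum_integral_consecutive:
  fixes f :: "real \<Rightarrow> real" and x :: "nat \<Rightarrow> real"
  assumes "\<And>m. x m \<le> x (Suc m)" "f integrable_on {x 1..x (Suc M)}"
  shows "(\<Sum>m=1..M. integral {x m..x (Suc m)} f) = integral {x 1..x (Suc M)} f"
  using assms(2)
proof (induction M)
  case 0
  then show ?case by simp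
next
  case (Suc M)
  have le: "x 1 \<le> x (Suc M)"
    using lift_Suc_mono_le[of x 1 "Suc M"] assms(1) by simp
  have "f integrable_on {x 1..x (Suc M)}"
    using Suc.prems by (rule integrable_subinterval_real) (use assms(1)[of "Suc M"] in auto)
  then show ?case
    using Suc.IH Henstock_Kurzweil_Integration.integral_combine[OF le assms(1) Suc.prems] by simp
qed

lemma ymesh_bounds:
  assumes "l > 0" "M \<ge> 1" "m \<in> {1..M}"
  shows "0 \<le> ymesh l M m" "ymesh l M (m + 1) \<le> l" "ymesh l M m \<le> ymesh l M (m + 1)"
proof -
  show "0 \<le> ymesh l M m" using assms by (simp add: ymesh_def)
  have "real m * l \<le> l * real M" using assms by (simp add: mult.commute)
  then show "ymesh l M (m + 1) \<le> l" using assms by (simp add: ymesh_def field_simps)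
  show "ymesh l M m \<le> ymesh l M (m + 1)" using assms by (simp add: ymesh_def divide_right_mono)
qed

lemma cell_subset:
  assumes "l > 0" "M \<ge> 1" "m \<in> {1..M}"
  shows "cell l M m \<subseteq> {0<..<l}"
  using ymesh_bounds[OF assms] by (auto simp: cell_def)

lemma sets_lebesgue_cell [simp]: "cell l M m \<in> sets lebesgue"
  by (simp add: cell_def)

lemma integrable_cell:
  fixes f :: "real \<Rightarrow> real"
  assumes "integrable (lebesgue_on {0<..<l}) f" "l > 0" "M \<ge> 1" "m \<in> {1..M}"
  shows "integrable (lebesgue_on (cell l M m)) f"
  using assms cell_subset by (intro integrable_lebesgue_on_subset[OF assms(1)]) auto

text \<open>
  The open cells miss the nodes.  Passing to gauge integrals, which are the same over an
  open interval and over its closure, turns the sum into one over adjacent closed intervals.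
\<close>

lemma sum_integral_cells:
  fixes f :: "real \<Rightarrow> real"
  assumes f: "integrable (lebesgue_on {0<..<l}) f" and l: "l > 0" and M: "M \<ge> 1"
  shows "(\<Sum>m=1..M. \<integral>y. f y \<partial>lebesgue_on (cell l M m)) = (\<integral>y. f y \<partial>lebesgue_on {0<..<l})"
proof -
  have "f integrable_on {0<..<l}" using f by (rule integrable_on_lebesgue_on) simp
  then have HK: "f integrable_on {0..l}" by (simp add: integrable_on_open_interval_real)
  have ends: "ymesh l M 1 = 0" "ymesh l M (Suc M) = l" using M by (auto simp: ymesh_def)
  have "(\<Sum>m=1..M. \<integral>y. f y \<partial>lebesgue_on (cell l M m))
      = (\<Sum>m=1..M. integral {ymesh l M m..ymesh l M (Suc m)} f)"
  proof (rule sum.cong[OF refl])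
    fix m assume "m \<in> {1..M}"
    then show "(\<integral>y. f y \<partial>lebesgue_on (cell l M m)) = integral {ymesh l M m..ymesh l M (Suc m)} f"
      using integrable_cell[OF f l M] integral_lebesgue_on_Ioo[of "ymesh l M m" "ymesh l M (Suc m)" f]
      by (simp add: cell_def)
  qed
  also have "\<dots> = integral {ymesh l M 1..ymesh l M (Suc M)} f"
    using l HK ends
    by (intro sum_integral_consecutive) (auto simp: ymesh_def divide_right_mono)
  also have "\<dots> = (\<integral>y. f y \<partial>lebesgue_on {0<..<l})"
    using ends integral_lebesgue_on_Ioo[OF f] by simp
  finally show ?thesis .
qed

section \<open>The L1 coefficients\<close>

lemma tmesh_strict_mono:
  assumes "T > 0" "N \<ge> 1" "r \<ge> 1" "1 \<le> i" "i < j"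
  shows "tmesh T N r i < tmesh T N r j"
proof -
  have "(real i - 1) / real N < (real j - 1) / real N"
    using assms by (simp add: divide_strict_right_mono)
  then show ?thesis
    unfolding tmesh_def using assms by (intro mult_strict_left_mono powr_less_mono2) auto
qed

lemma tmesh_1: "tmesh T N r 1 = 0"
  by (simp add: tmesh_def)

lemma tmesh_le:
  assumes "T > 0" "N \<ge> 1" "r \<ge> 1" "1 \<le> n" "n \<le> N + 1"
  shows "tmesh T N r n \<le> T"
proof -
  have "((real n - 1) / real N) powr r \<le> 1 powr r"
    using assms by (intro powr_mono2) (auto simp: field_simps)
  then show ?thesis using assms(1) by (simp add: tmesh_def)
qed

text \<open>
  Up to a factor, a coefficient is a difference quotient of \<open>s \<mapsto> - (t\<^sub>n - s) powr (1 - \<alpha>)\<close>,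
  so the mean value theorem identifies it with the fractional kernel at some point of
  its time interval.  For \<open>j + 1 = n\<close> the function is merely continuous at the right
  endpoint, which the mean value theorem allows.
\<close>

lemma L1_coeff_mean_value:
  assumes \<alpha>: "0 < \<alpha>" "\<alpha> < 1" and mesh: "T > 0" "N \<ge> 1" "r \<ge> 1" and j: "1 \<le> j" "j < n"
  obtains z where "tmesh T N r j < z" "z < tmesh T N r (j + 1)"
    "L1_coeff \<alpha> T N r n j = (tmesh T N r n - z) powr (- \<alpha>) / Gamma (1 - \<alpha>)"
proof -
  define tn where "tn = tmesh T N r n"
  define s where "s = tmesh T N r j"
  define t where "t = tmesh T N r (j + 1)"
  have st: "s < t" unfolding s_def t_def using mesh j by (intro tmesh_strict_mono) auto
  have tt: "t \<le> tn"
    using tmesh_strict_mono[OF mesh, of "j + 1" n] j by (cases "j + 1 = n") (auto simp: t_def tn_def)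
  have der: "((\<lambda>x. - ((tn - x) powr (1 - \<alpha>))) has_real_derivative (1 - \<alpha>) * (tn - x) powr (- \<alpha>)) (at x)"
    if "s < x" "x < t" for x
    using that tt by (auto intro!: derivative_eq_intros simp: algebra_simps)
  have cont: "continuous_on {s..t} (\<lambda>x. - ((tn - x) powr (1 - \<alpha>)))"
    using tt \<alpha> by (intro continuous_intros continuous_on_powr') auto
  obtain d z where z: "s < z" "z < t"
      and d: "((\<lambda>x. - ((tn - x) powr (1 - \<alpha>))) has_real_derivative d) (at z)"
      and eq: "- ((tn - t) powr (1 - \<alpha>)) - - ((tn - s) powr (1 - \<alpha>)) = (t - s) * d"
    using MVT[OF st cont] der real_differentiable_def by blast
  have deq: "d = (1 - \<alpha>) * (tn - z) powr (- \<alpha>)"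
    using DERIV_unique[OF d der[OF z]] .
  have G: "Gamma (2 - \<alpha>) = (1 - \<alpha>) * Gamma (1 - \<alpha>)"
    using Gamma_plus1[of "1 - \<alpha>"] \<alpha> nonpos_Ints_nonpos[of "1 - \<alpha>"] by auto
  have "L1_coeff \<alpha> T N r n j = ((t - s) * d) / ((t - s) * Gamma (2 - \<alpha>))"
    using eq by (simp add: L1_coeff_def tstep_def tn_def s_def t_def)
  also have "\<dots> = (tn - z) powr (- \<alpha>) / Gamma (1 - \<alpha>)"
    using st \<alpha> by (simp add: deq G)
  finally show thesis using z that by (simp add: tn_def s_def t_def)
qed

text \<open>The kernel increases towards its singularity at \<open>t\<^sub>n\<close>, hence so do its sampled values.\<close>

lemma L1_coeff_mono:
  assumes \<alpha>: "0 < \<alpha>" "\<alpha> < 1" and mesh: "T > 0" "N \<ge> 1" "r \<ge> 1" and j: "1 \<le> j" "j + 1 < n"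
  shows "L1_coeff \<alpha> T N r n j \<le> L1_coeff \<alpha> T N r n (j + 1)"
proof -
  obtain z where z: "z < tmesh T N r (j + 1)"
    "L1_coeff \<alpha> T N r n j = (tmesh T N r n - z) powr (- \<alpha>) / Gamma (1 - \<alpha>)"
    using L1_coeff_mean_value[OF \<alpha> mesh, of j n] j by auto
  obtain z' where z': "tmesh T N r (j + 1) < z'" "z' < tmesh T N r (j + 1 + 1)"
    "L1_coeff \<alpha> T N r n (j + 1) = (tmesh T N r n - z') powr (- \<alpha>) / Gamma (1 - \<alpha>)"
    using L1_coeff_mean_value[OF \<alpha> mesh, of "j + 1" n] j by auto
  have "tmesh T N r (j + 1 + 1) \<le> tmesh T N r n"
    using tmesh_strict_mono[OF mesh, of "j + 1 + 1" n] j by (cases "j + 1 + 1 = n") auto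
  then have "(tmesh T N r n - z) powr (- \<alpha>) \<le> (tmesh T N r n - z') powr (- \<alpha>)"
    using z z' \<alpha> by (intro powr_mono2') auto
  then show ?thesis using z z' \<alpha> by (simp add: divide_right_mono less_imp_le)
qed

text \<open>
  The oldest coefficient is the smallest one, and the kernel at a distance of at most
  \<open>T\<close> is at least \<open>T powr (- \<alpha>)\<close>.  This bound, free of the mesh parameters, is where
  the factor \<open>T powr \<alpha>\<close> of the stability estimate comes from.
\<close>

lemma L1_coeff_first_ge:
  assumes \<alpha>: "0 < \<alpha>" "\<alpha> < 1" and mesh: "T > 0" "N \<ge> 1" "r \<ge> 1" and n: "n \<in> {2..N+1}"
  shows "T powr (- \<alpha>) / Gamma (1 - \<alpha>) \<le> L1_coeff \<alpha> T N r n 1"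
proof -
  obtain z where z: "tmesh T N r 1 < z" "z < tmesh T N r (1 + 1)"
    "L1_coeff \<alpha> T N r n 1 = (tmesh T N r n - z) powr (- \<alpha>) / Gamma (1 - \<alpha>)"
    using L1_coeff_mean_value[OF \<alpha> mesh, of 1 n] n by auto
  have "tmesh T N r (1 + 1) \<le> tmesh T N r n"
    using tmesh_strict_mono[OF mesh, of "1 + 1" n] n by (cases "n = 2") (auto simp: numeral_2_eq_2)
  moreover have "tmesh T N r n \<le> T" using tmesh_le[OF mesh] n by auto
  ultimately have "T powr (- \<alpha>) \<le> (tmesh T N r n - z) powr (- \<alpha>)"
    using z \<alpha> tmesh_1[of T N r] by (intro powr_mono2') auto
  then show ?thesis using z \<alpha> by (simp add: divide_right_mono less_imp_le)
qed

section \<open>A discrete fractional comparison principle\<close>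

text \<open>
  The weights on the right of the recursion are nonnegative and add up to the weight
  \<open>W n (n - 1)\<close> on the left, so \<open>x n\<close> is at most a weighted mean of earlier values
  plus a source.  The value \<open>x 1\<close> alone enters the mean without the increment \<open>F / w\<close>;
  it carries the weight \<open>W n 1 \<ge> w\<close>, which leaves room for exactly one source \<open>F\<close>.
  Hence the increment does not accumulate with \<open>n\<close>.
\<close>

lemma weighted_mean_recursion_bound:
  fixes W :: "nat \<Rightarrow> nat \<Rightarrow> real" and x :: "nat \<Rightarrow> real"
  assumes rec: "\<And>n. n \<in> {2..K} \<Longrightarrow>
      W n (n - 1) * x n \<le> F + W n 1 * x 1 + (\<Sum>j=2..n-1. (W n j - W n (j - 1)) * x j)"
    and mono: "\<And>n j. n \<in> {2..K} \<Longrightarrow> j \<in> {2..n-1} \<Longrightarrow> W n (j - 1) \<le> W n j"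
    and low: "\<And>n. n \<in> {2..K} \<Longrightarrow> w \<le> W n 1"
    and "w > 0" "F \<ge> 0" and n: "n \<in> {2..K}"
  shows "x n \<le> x 1 + F / w"
  using n
proof (induction n rule: less_induct)
  case (less n)
  define S where "S = x 1 + F / w"
  have tele: "(\<Sum>j=2..n-1. W n j - W n (j - 1)) = W n (n - 1) - W n 1"
  proof -
    have "1 \<le> n - 1" using less.prems by auto
    then show ?thesis using sum_telescope''[of 1 "n - 1" "W n"] by (simp add: numeral_2_eq_2)
  qed
  have "0 \<le> (\<Sum>j=2..n-1. W n j - W n (j - 1))"
    using mono less.prems by (intro sum_nonneg) auto
  then have top: "0 < W n (n - 1)"
    using tele low[OF less.prems] \<open>w > 0\<close> by linarith
  have "F \<le> W n 1 * (F / w)"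
    using mult_right_mono[OF low[OF less.prems], of "F / w"] \<open>w > 0\<close> \<open>F \<ge> 0\<close> by simp
  then have start: "F + W n 1 * x 1 \<le> W n 1 * S"
    by (simp add: S_def distrib_left)
  have "(\<Sum>j=2..n-1. (W n j - W n (j - 1)) * x j) \<le> (\<Sum>j=2..n-1. (W n j - W n (j - 1)) * S)"
    using less mono by (intro sum_mono mult_left_mono) (auto simp: S_def)
  also have "\<dots> = (W n (n - 1) - W n 1) * S"
    by (simp only: tele sum_distrib_right[symmetric])
  finally have "W n (n - 1) * x n \<le> W n (n - 1) * S"
    using rec[OF less.prems] start by (simp add: algebra_simps)
  then show ?case using top by (simp add: S_def)
qed

section \<open>The energy estimate of one time step\<close>

text \<open>
  Inside a cell a broken polynomial and its derivative agree with polynomials, which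
  extend continuously to the closed cell; this makes the energy density integrable.
\<close>

lemma dg_energy_integrable:
  assumes w: "w \<in> dg_space l M k" and mesh: "l > 0" "M \<ge> 1" "m \<in> {1..M}"
    and K: "continuous_on {0..l} K" and c: "continuous_on {0..l} c"
  shows "integrable (lebesgue_on (cell l M m)) (\<lambda>y. K y * deriv w y * deriv w y + c y * w y * w y)"
proof -
  obtain q :: "real poly" where q: "\<And>y. y \<in> cell l M m \<Longrightarrow> w y = poly q y"
    using w mesh unfolding dg_space_def by blast
  have dq: "deriv w y = poly (pderiv q) y" if y: "y \<in> cell l M m" for y
  proof (rule DERIV_imp_deriv)
    have "open (cell l M m)" by (simp add: cell_def)
    then show "(w has_real_derivative poly (pderiv q) y) (at y)"
      using has_field_derivative_transform_within_open[OF poly_DERIV[of q y]] y q by metis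
  qed
  define I where "I = {ymesh l M m..ymesh l M (m + 1)}"
  have sub: "I \<subseteq> {0..l}" using ymesh_bounds[OF mesh] by (auto simp: I_def)
  have "continuous_on I
      (\<lambda>y. K y * poly (pderiv q) y * poly (pderiv q) y + c y * poly q y * poly q y)"
    by (intro continuous_intros continuous_on_subset[OF K sub] continuous_on_subset[OF c sub])
  then have "integrable (lebesgue_on I)
      (\<lambda>y. K y * poly (pderiv q) y * poly (pderiv q) y + c y * poly q y * poly q y)"
    unfolding I_def by (rule continuous_imp_integrable_real)
  then have "integrable (lebesgue_on (cell l M m))
      (\<lambda>y. K y * poly (pderiv q) y * poly (pderiv q) y + c y * poly q y * poly q y)"
    by (rule integrable_lebesgue_on_subset) (auto simp: I_def cell_def)
  then show ?thesis
    by (rule iffD1[OF Bochner_Integration.integrable_cong[OF refl], rotated]) (simp add: q dq)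
qed

text \<open>
  On the diagonal the two consistency terms of the nonsymmetric form cancel, and both
  the diffusion part and the penalty part are nonnegative.
\<close>

lemma nipg_form_diagonal_ge:
  assumes w: "w \<in> dg_space l M k" and mesh: "l > 0" "M \<ge> 1"
    and K: "continuous_on {0..l} K" "\<And>y. y \<in> {0..l} \<Longrightarrow> 0 \<le> K y"
    and c: "continuous_on {0..l} c" "\<And>y. y \<in> {0..l} \<Longrightarrow> \<gamma> \<le> c y"
    and \<sigma>: "\<And>m. m \<in> {1..M+1} \<Longrightarrow> 0 \<le> \<sigma> m"
  shows "\<gamma> * (L2_norm l w)\<^sup>2 \<le> nipg_form l M \<sigma> K c w w"
proof -
  have wsq: "integrable (lebesgue_on {0<..<l}) (\<lambda>y. \<gamma> * (w y)\<^sup>2)"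
    using w by (simp add: dg_space_def L2_def)
  have "\<gamma> * (L2_norm l w)\<^sup>2 = (\<Sum>m=1..M. \<integral>y. \<gamma> * (w y)\<^sup>2 \<partial>lebesgue_on (cell l M m))"
    using sum_integral_cells[OF wsq mesh] by (simp add: L2_norm_square)
  also have "\<dots> \<le> B1 l M K c w w"
    unfolding B1_def
  proof (rule sum_mono)
    fix m assume m: "m \<in> {1..M}"
    show "(\<integral>y. \<gamma> * (w y)\<^sup>2 \<partial>lebesgue_on (cell l M m))
        \<le> (\<integral>y. K y * deriv w y * deriv w y + c y * w y * w y \<partial>lebesgue_on (cell l M m))"
    proof (rule integral_mono)
      fix y assume "y \<in> space (lebesgue_on (cell l M m))"
      then have y: "y \<in> {0..l}" using cell_subset[OF mesh m] by auto
      have "0 \<le> K y * (deriv w y)\<^sup>2" using K(2)[OF y] by simp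
      moreover have "\<gamma> * (w y)\<^sup>2 \<le> c y * (w y)\<^sup>2" using c(2)[OF y] by (simp add: mult_right_mono)
      ultimately show "\<gamma> * (w y)\<^sup>2 \<le> K y * deriv w y * deriv w y + c y * w y * w y"
        by (simp add: power2_eq_square mult.assoc)
    qed (use integrable_cell[OF wsq mesh m] dg_energy_integrable[OF w mesh m K(1) c(1)] in auto)
  qed
  also have "\<dots> \<le> nipg_form l M \<sigma> K c w w"
  proof -
    have "0 \<le> B3 l M \<sigma> w w"
      unfolding B3_def using \<sigma> by (intro sum_nonneg) (simp add: mult.assoc)
    then show ?thesis by (simp add: nipg_form_def)
  qed
  finally show ?thesis .
qed

lemma L1_nipg_rhs_le:
  assumes mesh: "l > 0" "M \<ge> 1"
    and f: "(\<lambda>y. f y (tmesh T N r n)) \<in> L2 l" and v: "v \<in> L2 l"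
    and n: "2 \<le> n" and u: "\<And>j. j \<in> {1..n-1} \<Longrightarrow> u j \<in> L2 l"
    and first: "0 \<le> L1_coeff \<alpha> T N r n 1"
    and mono: "\<And>j. j \<in> {2..n-1} \<Longrightarrow> L1_coeff \<alpha> T N r n (j - 1) \<le> L1_coeff \<alpha> T N r n j"
  shows "L1_nipg_rhs \<alpha> l T f N r M u n v
    \<le> (L2_norm l (\<lambda>y. f y (tmesh T N r n)) + L1_coeff \<alpha> T N r n 1 * L2_norm l (u 1)
        + (\<Sum>j=2..n-1. (L1_coeff \<alpha> T N r n j - L1_coeff \<alpha> T N r n (j - 1)) * L2_norm l (u j)))
      * L2_norm l v"
proof -
  let ?\<mu> = "lebesgue_on {0<..<l}"
  let ?f = "\<lambda>y. f y (tmesh T N r n)"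
  define W where "W = L1_coeff \<alpha> T N r n"
  define d where "d j = W j - W (j - 1)" for j
  have fv: "integrable ?\<mu> (\<lambda>y. ?f y * v y)" using f v by (rule L2_integrable_mult)
  have uv: "integrable ?\<mu> (\<lambda>y. u j y * v y)" if "j \<in> {1..n-1}" for j
    using u[OF that] v by (rule L2_integrable_mult)
  have u1v: "integrable ?\<mu> (\<lambda>y. W 1 * (u 1 y * v y))" using uv[of 1] n by simp
  have sumv: "integrable ?\<mu> (\<lambda>y. \<Sum>j=2..n-1. d j * (u j y * v y))"
    using uv by (intro Bochner_Integration.integrable_sum integrable_mult_right) auto
  have split: "(?f y + W 1 * u 1 y + (\<Sum>j=2..n-1. d j * u j y)) * v y
      = ?f y * v y + W 1 * (u 1 y * v y) + (\<Sum>j=2..n-1. d j * (u j y * v y))" for y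
    by (simp add: distrib_right sum_distrib_right mult.assoc)
  have "L1_nipg_rhs \<alpha> l T f N r M u n v
      = (\<Sum>m=1..M. \<integral>y. ?f y * v y + W 1 * (u 1 y * v y)
          + (\<Sum>j=2..n-1. d j * (u j y * v y)) \<partial>lebesgue_on (cell l M m))"
    unfolding L1_nipg_rhs_def W_def[symmetric] d_def[symmetric] split ..
  also have "\<dots> = (\<integral>y. ?f y * v y + W 1 * (u 1 y * v y) + (\<Sum>j=2..n-1. d j * (u j y * v y)) \<partial>?\<mu>)"
    using fv u1v sumv by (intro sum_integral_cells mesh Bochner_Integration.integrable_add)
  also have "\<dots> = (\<integral>y. ?f y * v y \<partial>?\<mu>) + W 1 * (\<integral>y. u 1 y * v y \<partial>?\<mu>)
      + (\<Sum>j=2..n-1. d j * (\<integral>y. u j y * v y \<partial>?\<mu>))"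
  proof -
    have "(\<integral>y. (\<Sum>j=2..n-1. d j * (u j y * v y)) \<partial>?\<mu>) = (\<Sum>j=2..n-1. d j * (\<integral>y. u j y * v y \<partial>?\<mu>))"
      using uv by (subst Bochner_Integration.integral_sum) auto
    then show ?thesis using fv u1v sumv by simp
  qed
  also have "\<dots> \<le> L2_norm l ?f * L2_norm l v + W 1 * (L2_norm l (u 1) * L2_norm l v)
      + (\<Sum>j=2..n-1. d j * (L2_norm l (u j) * L2_norm l v))"
    using f v u first mono n
    by (intro add_mono sum_mono mult_left_mono L2_integral_mult_le) (auto simp: W_def d_def)
  also have "\<dots> = (L2_norm l ?f + W 1 * L2_norm l (u 1)
      + (\<Sum>j=2..n-1. d j * L2_norm l (u j))) * L2_norm l v"
    by (simp add: distrib_right sum_distrib_right mult.assoc)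
  finally show ?thesis by (simp add: W_def d_def)
qed

theorem lemma3p3:
  fixes \<alpha> l T :: real and a b p :: "real \<Rightarrow> real"
  assumes "0 < \<alpha>" "\<alpha> < 1" "l > 0" "T > 0"
    and "C1_on_Icc l a" "continuous_on {0..l} b" "continuous_on {0..T} p"
    and "\<forall>y\<in>{0..l}. a y > 0" "\<forall>t\<in>{0..T}. p t > 0" "\<forall>y\<in>{0..l}. b y \<ge> 0"
  shows "\<exists>C>0. \<forall>(g :: real \<Rightarrow> real) (f :: real \<Rightarrow> real \<Rightarrow> real) (N :: nat) (r :: real)
      (M :: nat) (k :: nat) (\<sigma> :: nat \<Rightarrow> real) (u :: nat \<Rightarrow> real \<Rightarrow> real).
    g \<in> L2 l \<longrightarrow> g 0 = 0 \<longrightarrow> g l = 0 \<longrightarrow>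
    N \<ge> 1 \<longrightarrow> r \<ge> 1 \<longrightarrow> M \<ge> 1 \<longrightarrow> k \<ge> 1 \<longrightarrow> (\<forall>m\<in>{1..M+1}. \<sigma> m \<ge> 0) \<longrightarrow>
    (\<forall>j\<in>{1..N+1}. (\<lambda>y. f y (tmesh T N r j)) \<in> L2 l) \<longrightarrow>
    L1_nipg_solution \<alpha> l T a b p g f N r M k \<sigma> u \<longrightarrow>
    (\<forall>n\<in>{2..N+1}. L2_norm l (u n) \<le> L2_norm l (u 1)
        + C * T powr \<alpha> * Max ((\<lambda>j. L2_norm l (\<lambda>y. f y (tmesh T N r j))) ` {1..n}))"
proof -
  define w where "w = T powr (- \<alpha>) / Gamma (1 - \<alpha>)"
  have w: "w > 0" using assms by (simp add: w_def)
  show ?thesis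
  proof (intro exI[of _ "Gamma (1 - \<alpha>)"] conjI allI impI ballI)
    show "Gamma (1 - \<alpha>) > 0" using assms by simp
    fix g :: "real \<Rightarrow> real" and f :: "real \<Rightarrow> real \<Rightarrow> real" and N :: nat and r :: real
      and M k :: nat and \<sigma> :: "nat \<Rightarrow> real" and u :: "nat \<Rightarrow> real \<Rightarrow> real" and n :: nat
    assume mesh: "N \<ge> 1" "r \<ge> 1" and M: "M \<ge> 1" and \<sigma>: "\<forall>m\<in>{1..M+1}. \<sigma> m \<ge> 0"
      and f: "\<forall>j\<in>{1..N+1}. (\<lambda>y. f y (tmesh T N r j)) \<in> L2 l"
      and sol: "L1_nipg_solution \<alpha> l T a b p g f N r M k \<sigma> u" and n: "n \<in> {2..N+1}"
    note \<alpha> = \<open>0 < \<alpha>\<close> \<open>\<alpha> < 1\<close>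
    define F where "F = Max ((\<lambda>j. L2_norm l (\<lambda>y. f y (tmesh T N r j))) ` {1..n})"
    have F: "L2_norm l (\<lambda>y. f y (tmesh T N r i)) \<le> F" if "i \<in> {1..n}" for i
      unfolding F_def using that by (intro Max_ge) auto
    have F0: "0 \<le> F" using F[of 1] n L2_norm_nonneg[of l "\<lambda>y. f y (tmesh T N r 1)"] by auto
    define W where "W i = L1_coeff \<alpha> T N r i" for i
    have low: "w \<le> W i 1" if "i \<in> {2..n}" for i
      unfolding w_def W_def using that n by (intro L1_coeff_first_ge \<alpha> mesh \<open>T > 0\<close>) auto
    have mono: "W i (j - 1) \<le> W i j" if "i \<in> {2..n}" "j \<in> {2..i-1}" for i j
    proof -
      have "1 \<le> j - 1" "j - 1 + 1 < i" "j - 1 + 1 = j" using that by auto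
      then show ?thesis using L1_coeff_mono[OF \<alpha> \<open>T > 0\<close> mesh, of "j - 1" i] by (simp add: W_def)
    qed
    have dg: "u i \<in> dg_space l M k" if "i \<in> {1..N+1}" for i
      using sol that by (simp add: L1_nipg_solution_def)
    then have L2u: "u i \<in> L2 l" if "i \<in> {1..N+1}" for i
      using that by (simp add: dg_space_def)
    have step: "W i (i - 1) * L2_norm l (u i) \<le> F + W i 1 * L2_norm l (u 1)
        + (\<Sum>j=2..i-1. (W i j - W i (j - 1)) * L2_norm l (u j))" (is "_ \<le> ?R")
      if i: "i \<in> {2..n}" for i
    proof -
      let ?t = "tmesh T N r i"
      have t: "?t \<in> {0..T}"
        using i n tmesh_le[OF \<open>T > 0\<close> mesh, of i]
          tmesh_strict_mono[OF \<open>T > 0\<close> mesh, of 1 i] tmesh_1[of T N r] by auto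
      have p: "0 < p ?t" using assms t by blast
      have "continuous_on {0..l} a"
        using \<open>C1_on_Icc l a\<close> unfolding C1_on_Icc_def
        by (meson DERIV_continuous_on)
      have "W i (i - 1) * (L2_norm l (u i))\<^sup>2
          \<le> nipg_form l M \<sigma> (\<lambda>y. p ?t * a y) (\<lambda>y. p ?t * b y + W i (i - 1)) (u i) (u i)"
        using i n p assms \<sigma> M \<open>continuous_on {0..l} a\<close>
        by (intro nipg_form_diagonal_ge[OF dg] continuous_intros) (auto simp: less_imp_le)
      also have "\<dots> = L1_nipg_rhs \<alpha> l T f N r M u i (u i)"
        using sol i n dg unfolding L1_nipg_solution_def W_def by auto
      also have "\<dots> \<le> (L2_norm l (\<lambda>y. f y ?t) + W i 1 * L2_norm l (u 1)
          + (\<Sum>j=2..i-1. (W i j - W i (j - 1)) * L2_norm l (u j))) * L2_norm l (u i)"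
        unfolding W_def
        using i n f L2u M \<open>l > 0\<close> low[OF i] mono[OF i] w
        by (intro L1_nipg_rhs_le) (auto simp: W_def)
      also have "\<dots> \<le> ?R * L2_norm l (u i)"
        using F[of i] i L2_norm_nonneg[of l "u i"] by (intro mult_right_mono) auto
      finally have energy: "(W i (i - 1) * L2_norm l (u i)) * L2_norm l (u i) \<le> ?R * L2_norm l (u i)"
        by (simp add: power2_eq_square mult.assoc)
      have "0 \<le> ?R"
        using F0 low[OF i] mono[OF i] w L2_norm_nonneg
        by (intro add_nonneg_nonneg sum_nonneg mult_nonneg_nonneg) auto
      then show ?thesis
        using energy L2_norm_nonneg[of l "u i"] by (cases "L2_norm l (u i) = 0") auto
    qed
    have "L2_norm l (u n) \<le> L2_norm l (u 1) + F / w"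
      using weighted_mean_recursion_bound[where x = "\<lambda>j. L2_norm l (u j)", OF step mono low w F0] n
      by auto
    also have "F / w = Gamma (1 - \<alpha>) * T powr \<alpha> * F"
      by (simp add: w_def powr_minus field_simps)
    finally show "L2_norm l (u n) \<le> L2_norm l (u 1) + Gamma (1 - \<alpha>) * T powr \<alpha>
        * Max ((\<lambda>j. L2_norm l (\<lambda>y. f y (tmesh T N r j))) ` {1..n})"
      unfolding F_def .
  qed
qed

end
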